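(* Let $p$ be a prime and let $G$ and $H$ be two finite groups of conjugate type $(p,1)$. If $|\mathrm{Cent}(G)|=|\mathrm{Cent}(H)|$, then $G$ is isoclinic with $H$.
   Context: $\mathrm{Cent}(G)=\{C_G(x): x\in G\}$ is the set of centralizers of elements of $G$. A finite group $G$ is of conjugate type $(m,1)$ if every proper element centralizer (i.e. $C_G(x)$ for $x\in G\setminus Z(G)$) has index $m$ in $G$; such groups are understood to be non-abelian (exactly two conjugacy class sizes, $m$ and $1$). Two groups $G$ and $H$ are isoclinic if there are isomorphisms $\varphi:G/Z(G)\to H/Z(H)$ and $\phi:G'\to H'$ (where $'$ denotes the commutator subgroup) such that whenever $\varphi(g_iZ(G))=h_iZ(H)$ for $i=1,2$ ($g_i\in G$, $h_i\in H$), one has $\phi([g_1,g_2])=[h_1,h_2]$. *)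

theory Defs
  imports "HOL-Algebra.Algebra"
begin

definition centralizer :: "('a, 'b) monoid_scheme \<Rightarrow> 'a \<Rightarrow> 'a set" where
  "centralizer G x = {g \<in> carrier G. g \<otimes>\<^bsub>G\<^esub> x = x \<otimes>\<^bsub>G\<^esub> g}"

definition group_center :: "('a, 'b) monoid_scheme \<Rightarrow> 'a set" where
  "group_center G = {z \<in> carrier G. \<forall>g \<in> carrier G. z \<otimes>\<^bsub>G\<^esub> g = g \<otimes>\<^bsub>G\<^esub> z}"

definition Cent :: "('a, 'b) monoid_scheme \<Rightarrow> 'a set set" where
  "Cent G = {centralizer G x | x. x \<in> carrier G}"

definition conjugate_type :: "('a, 'b) monoid_scheme \<Rightarrow> nat \<Rightarrow> bool" where
  \<comment> \<open>Conjugate type \<open>(m, 1)\<close>. The non-commutativity clause reflects that both class sizes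
      occur; without it every abelian group would qualify vacuously, for every \<open>m\<close>.\<close>
  "conjugate_type G m \<longleftrightarrow>
     \<not> comm_group G \<and>
     (\<forall>x \<in> carrier G - group_center G. card (rcosets\<^bsub>G\<^esub> (centralizer G x)) = m)"

definition commutator :: "('a, 'b) monoid_scheme \<Rightarrow> 'a \<Rightarrow> 'a \<Rightarrow> 'a" where
  \<comment> \<open>Same convention as in \<open>derived_set\<close>, so \<open>derived G (carrier G)\<close> is generated by these.\<close>
  "commutator G x y = x \<otimes>\<^bsub>G\<^esub> y \<otimes>\<^bsub>G\<^esub> inv\<^bsub>G\<^esub> x \<otimes>\<^bsub>G\<^esub> inv\<^bsub>G\<^esub> y"

definition isoclinic :: "('a, 'c) monoid_scheme \<Rightarrow> ('b, 'd) monoid_scheme \<Rightarrow> bool" where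
  \<comment> \<open>The quotient \<open>Mod\<close> has right cosets as its elements, hence \<open>group_center G #> g\<close>;
      this equals the left coset of \<open>g\<close> because the center is normal.\<close>
  "isoclinic G H \<longleftrightarrow>
     (\<exists>\<phi> \<in> iso (G Mod group_center G) (H Mod group_center H).
      \<exists>\<psi> \<in> iso (G\<lparr>carrier := derived G (carrier G)\<rparr>) (H\<lparr>carrier := derived H (carrier H)\<rparr>).
        \<forall>g\<^sub>1 \<in> carrier G. \<forall>g\<^sub>2 \<in> carrier G. \<forall>h\<^sub>1 \<in> carrier H. \<forall>h\<^sub>2 \<in> carrier H.
          \<phi> (group_center G #>\<^bsub>G\<^esub> g\<^sub>1) = group_center H #>\<^bsub>H\<^esub> h\<^sub>1 \<longrightarrow>
          \<phi> (group_center G #>\<^bsub>G\<^esub> g\<^sub>2) = group_center H #>\<^bsub>H\<^esub> h\<^sub>2 \<longrightarrow>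
          \<psi> (commutator G g\<^sub>1 g\<^sub>2) = commutator H h\<^sub>1 h\<^sub>2)"

end

theory Submission
  imports Defs
begin

text \<open>
  Let \<open>G\<close> have conjugate type \<open>(p, 1)\<close>. If \<open>w\<^sup>q\<close> is central for a prime \<open>q \<noteq> p\<close>, then \<open>w\<close> commutes with
  a point of every class of size \<open>p\<close>, and counting shows that \<open>w\<close> is central; so \<open>G\<close> is a \<open>p\<close>-group
  modulo its center. Orbits on a class of size \<open>p\<close> then force the proper centralizers to be normal of
  index \<open>p\<close>, hence \<open>G\<close> has class 2, and its commutators form a single group \<open>\<langle>c\<rangle>\<close> of order \<open>p\<close>.
  The commutator thus is a nondegenerate alternating form on \<open>G/Z\<close> over the field with \<open>p\<close> elements, and
  the proper centralizers correspond to the lines of \<open>G/Z\<close>. Their number determines \<open>|G/Z| = p\<^sup>2\<^sup>n\<close>, and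
  symplectic bases of \<open>G\<close> and \<open>H\<close> of equal length provide the isoclinism.
\<close>

subsection \<open>Centralizers and conjugacy classes\<close>

text \<open>The iterates of \<open>f\<close> act on \<open>S\<close> as a cyclic group of order
  dividing \<open>q\<close>, so \<open>S\<close> splits into orbits. Each orbit has exactly
  \<open>q\<close> points, because a shorter one would yield a fixed point.\<close>

lemma prime_dvd_card_if_no_fixpoint:
  fixes f :: "'a \<Rightarrow> 'a"
  assumes "finite S" and q: "Factorial_Ring.prime (q::nat)" and fS: "\<And>u. u \<in> S \<Longrightarrow> f u \<in> S"
    and fq: "\<And>u. u \<in> S \<Longrightarrow> (f ^^ q) u = u" and nofix: "\<And>u. u \<in> S \<Longrightarrow> f u \<noteq> u"
  shows "q dvd card S"
proof (rule equiv_imp_dvd_card[OF \<open>finite S\<close>])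
  define r where "r = {(u, v). u \<in> S \<and> v \<in> S \<and> (\<exists>i. v = (f ^^ i) u)}"
  have q0: "q > 0" using q by (simp add: prime_gt_0_nat)
  have fi: "(f ^^ i) u \<in> S" if "u \<in> S" for i u
    using that by (induction i) (auto intro: fS)
  have period: "(f ^^ (q * k)) u = u" if "u \<in> S" for k u
    using that by (induction k) (auto simp: funpow_add fq)
  have modq: "(f ^^ i) u = (f ^^ (i mod q)) u" if "u \<in> S" for i u
  proof -
    have "(f ^^ i) u = (f ^^ (i mod q + q * (i div q))) u" by simp
    also have "\<dots> = (f ^^ (i mod q)) ((f ^^ (q * (i div q))) u)" by (simp only: funpow_add o_def)
    finally show ?thesis using period[OF that] by simp
  qed
  show "equiv S r"
  proof (rule equivI)
    show "r \<subseteq> S \<times> S" by (auto simp: r_def)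
    show "refl_on S r" by (auto simp: r_def refl_on_def intro: exI[of _ 0])
    show "sym r"
    proof (rule symI)
      fix u v assume "(u, v) \<in> r"
      then obtain i where uv: "u \<in> S" "v \<in> S" "v = (f ^^ i) u" by (auto simp: r_def)
      \<comment> \<open>This power undoes \<open>f ^^ i\<close> on \<open>S\<close>; as
        \<open>q\<close> is positive, the subtraction does not truncate.\<close>
      have "(f ^^ (q * i - i)) v = (f ^^ (q * i - i + i)) u" using uv by (simp only: funpow_add o_def)
      also have "q * i - i + i = q * i" using q0 by simp
      finally have "u = (f ^^ (q * i - i)) v" using period uv by simp
      then show "(v, u) \<in> r" using uv by (auto simp: r_def)
    qed
    show "trans r"
    proof (rule transI)
      fix u v w assume "(u, v) \<in> r" "(v, w) \<in> r"
      then obtain i j where "u \<in> S" "w \<in> S" "v = (f ^^ i) u" "w = (f ^^ j) v" by (auto simp: r_def)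
      then have "w = (f ^^ (j + i)) u" by (simp add: funpow_add)
      then show "(u, w) \<in> r" using \<open>u \<in> S\<close> \<open>w \<in> S\<close> by (auto simp: r_def)
    qed
  qed
  fix Y assume "Y \<in> S // r"
  then obtain u where u: "u \<in> S" "Y = r `` {u}" by (auto elim: quotientE)
  have "Y = (\<lambda>i. (f ^^ i) u) ` {..<q}"
  proof (intro equalityI subsetI)
    fix v assume "v \<in> Y"
    then obtain i where "v = (f ^^ i) u" using u by (auto simp: r_def)
    then show "v \<in> (\<lambda>i. (f ^^ i) u) ` {..<q}"
      using modq[OF u(1)] q0 by (intro image_eqI[of _ _ "i mod q"]) auto
  next
    fix v assume "v \<in> (\<lambda>i. (f ^^ i) u) ` {..<q}"
    then show "v \<in> Y" using u fi by (auto simp: r_def)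
  qed
  moreover have "inj_on (\<lambda>i. (f ^^ i) u) {..<q}"
  proof (rule linorder_inj_onI')
    fix i j assume ij: "i \<in> {..<q}" "j \<in> {..<q}" "i < j"
    show "(f ^^ i) u \<noteq> (f ^^ j) u"
    proof
      assume eq: "(f ^^ i) u = (f ^^ j) u"
      define v d where "v = (f ^^ i) u" and "d = j - i"
      have v: "v \<in> S" using fi u v_def by auto
      have "(f ^^ d) v = (f ^^ (d + i)) u" unfolding v_def by (simp only: funpow_add o_def)
      then have dv: "(f ^^ d) v = v" using eq ij by (simp add: d_def v_def)
      have dk: "(f ^^ (d * k)) v = v" for k
        by (induction k) (auto simp: funpow_add dv)
      have "0 < d" "d < q" using ij by (auto simp: d_def)
      then have "\<not> q dvd d" by (auto dest: dvd_imp_le)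
      then have "coprime d q" using q prime_imp_coprime coprime_commute by blast
      moreover have "d \<noteq> 0" using \<open>0 < d\<close> by simp
      \<comment> \<open>\<open>v\<close> is fixed by \<open>f ^^ d\<close> and by
        \<open>f ^^ q\<close>, so Bezout makes it a fixed point of \<open>f\<close> itself.\<close>
      ultimately obtain s t where "d * s = q * t + 1"
        using bezout_nat[of d q] by auto
      then have "f v = v" using dk[of s] period[OF v, of t] by simp
      then show False using nofix v by blast
    qed
  qed
  ultimately have "card Y = q" by (simp add: card_image)
  then show "q dvd card Y" by simp
qed

context group
begin

section \<open>Powers and subgroups of prime order\<close>

lemma inv_cancel_left [simp]:
  assumes "x \<in> carrier G" "y \<in> carrier G"
  shows "inv x \<otimes> (x \<otimes> y) = y" and "x \<otimes> (inv x \<otimes> y) = y"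
  using assms by (simp_all add: m_assoc[symmetric])

text \<open>By Bezout, \<open>w\<close> is a product of integer powers of \<open>w [^] a\<close> and
  \<open>w [^] b\<close>.\<close>

lemma coprime_pow_mem:
  assumes K: "subgroup K G" and w: "w \<in> carrier G" and "w [^] (a::nat) \<in> K" "w [^] (b::nat) \<in> K"
    and "coprime a b"
  shows "w \<in> K"
proof -
  obtain s t where st: "s * int a + t * int b = 1"
    using bezout_int[of "int a" "int b"] \<open>coprime a b\<close> by auto
  have "w [^] (int a * s) \<in> K" "w [^] (int b * t) \<in> K"
    using subgroup_int_pow_closed[OF K, of "w [^] a" s] subgroup_int_pow_closed[OF K, of "w [^] b" t] assms
    by (simp_all add: int_pow_int[symmetric] int_pow_pow)
  then have "w [^] (int a * s + int b * t) \<in> K"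
    using w by (simp add: int_pow_mult subgroup.m_closed[OF K])
  then show ?thesis using st w by (simp add: mult.commute)
qed

text \<open>Lagrange inside \<open>K\<close>: the order of \<open>c\<close> divides a prime and is
  not 1, so the powers of \<open>c\<close> fill \<open>K\<close>.\<close>

lemma prime_order_subgroup_generated:
  assumes K: "subgroup K G" and "Factorial_Ring.prime (card K)" and c: "c \<in> K" "c \<noteq> \<one>"
  shows "ord c = card K" and "K = range (\<lambda>i::int. c [^] i)"
proof -
  have fin: "finite K" using \<open>Factorial_Ring.prime (card K)\<close> by (intro card_ge_0_finite) (simp add: prime_gt_0_nat)
  have cG: "c \<in> carrier G" using K c subgroup.mem_carrier by metis
  interpret K: group "G\<lparr>carrier := K\<rparr>" using subgroup.subgroup_is_group[OF K] is_group by simp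
  have "c [^] card K = \<one>"
    using K.pow_order_eq_1[of c] c by (simp add: order_def nat_pow_consistent[symmetric])
  then have "ord c dvd card K" using pow_eq_id cG by simp
  moreover have "ord c \<noteq> 1" using c cG ord_eq_1 by simp
  ultimately show o: "ord c = card K" using \<open>Factorial_Ring.prime (card K)\<close> prime_nat_iff by blast
  have "generate G {c} \<subseteq> K" using generate_subgroup_incl[of "{c}" K] K c by simp
  moreover have "card (generate G {c}) = card K" using o generate_pow_card cG by simp
  ultimately have "generate G {c} = K" using card_subset_eq fin by blast
  then show "K = range (\<lambda>i::int. c [^] i)" using generate_pow[OF cG] by auto
qed

lemma prime_order_comm_group:
  assumes "Factorial_Ring.prime (order G)"
  shows "comm_group G"
proof (rule group_comm_groupI)
  fix x y assume xy: "x \<in> carrier G" "y \<in> carrier G"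
  show "x \<otimes> y = y \<otimes> x"
  proof (cases "x = \<one>")
    case False
    then obtain i :: int where "y = x [^] i"
      using prime_order_subgroup_generated(2)[OF subgroup_self] assms xy by (auto simp: order_def)
    then show ?thesis using int_pow_mult[of x 1 i] int_pow_mult[of x i 1] xy by (simp add: add.commute)
  qed (use xy in simp)
qed

section \<open>Centralizers and the center\<close>

lemma centralizer_subgroup:
  assumes x: "x \<in> carrier G"
  shows "subgroup (centralizer G x) G"
proof (rule subgroupI)
  show "centralizer G x \<noteq> {}" using x by (auto simp: centralizer_def intro!: exI[of _ \<one>])
next
  fix a assume "a \<in> centralizer G x"
  then have a: "a \<in> carrier G" "a \<otimes> x = x \<otimes> a" by (auto simp: centralizer_def)
  then have "inv a \<otimes> (a \<otimes> x) \<otimes> inv a = inv a \<otimes> (x \<otimes> a) \<otimes> inv a" by simp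
  then show "inv a \<in> centralizer G x" using a(1) x by (simp add: m_assoc centralizer_def)
next
  fix a b assume "a \<in> centralizer G x" "b \<in> centralizer G x"
  then have ab: "a \<in> carrier G" "a \<otimes> x = x \<otimes> a" "b \<in> carrier G" "b \<otimes> x = x \<otimes> b"
    by (auto simp: centralizer_def)
  have "a \<otimes> b \<otimes> x = a \<otimes> (b \<otimes> x)" using ab x by (simp add: m_assoc)
  also have "\<dots> = (a \<otimes> x) \<otimes> b" unfolding ab(4) using ab(1,3) x by (simp add: m_assoc)
  also have "\<dots> = x \<otimes> (a \<otimes> b)" unfolding ab(2) using ab(1,3) x by (simp add: m_assoc)
  finally show "a \<otimes> b \<in> centralizer G x" using ab by (simp add: centralizer_def)
qed (auto simp: centralizer_def)

lemma group_center_eq: "group_center G = {z \<in> carrier G. \<forall>x \<in> carrier G. z \<in> centralizer G x}"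
  by (auto simp: group_center_def centralizer_def)

lemma group_center_subgroup: "subgroup (group_center G) G"
proof -
  have "group_center G = (\<Inter>x \<in> carrier G. centralizer G x)"
    by (auto simp: group_center_def centralizer_def)
  then show ?thesis
    by (simp only:) (rule subgroups_Inter, auto intro: centralizer_subgroup)
qed

lemma group_center_normal: "group_center G \<lhd> G"
  unfolding normal_inv_iff
  using group_center_subgroup by (auto simp: group_center_def m_assoc) 

lemma centralizer_mem_commute:
  "x \<in> carrier G \<Longrightarrow> y \<in> carrier G \<Longrightarrow> x \<in> centralizer G y \<longleftrightarrow> y \<in> centralizer G x"
  by (auto simp: centralizer_def)

lemma centralizer_self: "x \<in> carrier G \<Longrightarrow> x \<in> centralizer G x"
  by (simp add: centralizer_def)

lemma group_center_subset_centralizer: "x \<in> carrier G \<Longrightarrow> group_center G \<subseteq> centralizer G x"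
  by (auto simp: centralizer_def group_center_def)

lemma mem_centralizer_iff_conj:
  "x \<in> carrier G \<Longrightarrow> g \<in> carrier G \<Longrightarrow> g \<in> centralizer G x \<longleftrightarrow> g \<otimes> x \<otimes> inv g = x"
  by (simp add: centralizer_def inv_solve_right')

section \<open>Conjugacy classes\<close>

definition conj_class :: "'a \<Rightarrow> 'a set" where
  "conj_class x = (\<lambda>g. g \<otimes> x \<otimes> inv g) ` carrier G"

lemma conj_class_closed: "x \<in> carrier G \<Longrightarrow> conj_class x \<subseteq> carrier G"
  by (auto simp: conj_class_def)

lemma conj_class_self: "x \<in> carrier G \<Longrightarrow> x \<in> conj_class x"
  by (auto simp: conj_class_def intro!: image_eqI[of _ _ \<one>])

lemma conj_class_conj:
  assumes "x \<in> carrier G" "u \<in> conj_class x" "g \<in> carrier G"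
  shows "g \<otimes> u \<otimes> inv g \<in> conj_class x"
proof -
  obtain h where "h \<in> carrier G" "u = h \<otimes> x \<otimes> inv h" using assms by (auto simp: conj_class_def)
  then have "g \<otimes> u \<otimes> inv g = (g \<otimes> h) \<otimes> x \<otimes> inv (g \<otimes> h)"
    using assms by (simp add: m_assoc inv_mult_group)
  then show ?thesis using \<open>h \<in> carrier G\<close> assms unfolding conj_class_def by blast
qed

lemma conj_class_sym:
  assumes "x \<in> carrier G" "u \<in> conj_class x"
  shows "x \<in> conj_class u"
proof -
  obtain h where "h \<in> carrier G" "u = h \<otimes> x \<otimes> inv h" using assms by (auto simp: conj_class_def)
  then show ?thesis
    using assms unfolding conj_class_def by (intro image_eqI[of _ _ "inv h"]) (simp_all add: m_assoc)
qed

text \<open>For the conjugation action, whose stabilizers are the centralizers, the orbit-stabilizer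
  theorem is compared with Lagrange. This turns the index in \<open>conjugate_type\<close> into a
  class size.\<close>

lemma card_conj_class:
  assumes "finite (carrier G)" and x: "x \<in> carrier G"
  shows "card (conj_class x) = card (rcosets (centralizer G x))"
proof -
  interpret A: group_action G "carrier G" "\<lambda>g. \<lambda>h \<in> carrier G. g \<otimes> h \<otimes> inv g"
    by (rule action_by_conjugation)
  have "orbit G (\<lambda>g. \<lambda>h \<in> carrier G. g \<otimes> h \<otimes> inv g) x = conj_class x"
    using x by (auto simp: orbit_def conj_class_def)
  moreover have "stabilizer G (\<lambda>g. \<lambda>h \<in> carrier G. g \<otimes> h \<otimes> inv g) x = centralizer G x"
    using x mem_centralizer_iff_conj by (auto simp: stabilizer_def centralizer_def)
  ultimately have "card (conj_class x) * card (centralizer G x) = order G"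
    using A.orbit_stabilizer_theorem[OF x] by simp
  moreover have "card (rcosets (centralizer G x)) * card (centralizer G x) = order G"
    using lagrange centralizer_subgroup x by blast
  moreover have "order G > 0" using assms order_gt_0_iff_finite by simp
  ultimately show ?thesis by (metis mult_right_cancel gr0I less_numeral_extra(3) mult_0_right)
qed

end

subsection \<open>Commutators are central\<close>

locale conj_type_group = group G for G (structure) +
  fixes p :: nat
  assumes fin: "finite (carrier G)" and prime_p: "Factorial_Ring.prime p"
    and conj_type: "conjugate_type G p"
begin

abbreviation Z :: "'a set" where "Z \<equiv> group_center G"
abbreviation C :: "'a \<Rightarrow> 'a set" where "C \<equiv> centralizer G"

lemma Z_closed: "z \<in> Z \<Longrightarrow> z \<in> carrier G"
  by (simp add: group_center_def)

lemma C_closed: "g \<in> C x \<Longrightarrow> g \<in> carrier G"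
  by (simp add: centralizer_def)

lemma Z_commute: "z \<in> Z \<Longrightarrow> g \<in> carrier G \<Longrightarrow> z \<otimes> g = g \<otimes> z"
  unfolding group_center_def by blast

lemma C_commute: "g \<in> C x \<Longrightarrow> g \<otimes> x = x \<otimes> g"
  unfolding centralizer_def by blast

lemma finite_Z: "finite Z" and finite_C: "finite (C x)"
proof -
  show "finite Z" by (rule finite_subset[OF _ fin]) (auto simp: Z_closed)
  show "finite (C x)" by (rule finite_subset[OF _ fin]) (auto simp: C_closed)
qed

lemma card_Z_pos: "card Z > 0"
  using finite_Z subgroup.one_closed[OF group_center_subgroup] by (auto simp: card_gt_0_iff)

lemma card_class:
  assumes "x \<in> carrier G - Z"
  shows "card (conj_class x) = p"
  using assms conj_type card_conj_class[OF fin] by (auto simp: conjugate_type_def)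

lemma card_centralizer:
  assumes "x \<in> carrier G - Z"
  shows "p * card (C x) = order G"
  using lagrange[OF centralizer_subgroup, of x] assms conj_type by (simp add: conjugate_type_def)

lemma C_Z: "z \<in> Z \<Longrightarrow> C z = carrier G"
  unfolding centralizer_def using Z_commute[of z] by (intro equalityI subsetI CollectI conjI) auto

text \<open>All proper centralizers have the same order, so one cannot lie strictly inside
  another.\<close>

lemma C_eqI:
  assumes x: "x \<in> carrier G - Z" and y: "y \<in> carrier G - Z" and "C x \<subseteq> C y"
  shows "C x = C y"
proof (rule card_subset_eq[OF finite_C \<open>C x \<subseteq> C y\<close>])
  show "card (C x) = card (C y)"
    using card_centralizer[OF x] card_centralizer[OF y] prime_p
    by (metis mult_left_cancel not_prime_0)
qed

lemma conj_class_noncentral: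
  assumes x: "x \<in> carrier G - Z" and u: "u \<in> conj_class x"
  shows "u \<in> carrier G - Z"
proof
  show "u \<in> carrier G" using conj_class_closed[of x] assms by auto
  show "u \<notin> Z"
  proof
    assume "u \<in> Z"
    moreover have "u \<in> carrier G" using Z_closed \<open>u \<in> Z\<close> by blast
    moreover obtain g where "g \<in> carrier G" "x = g \<otimes> u \<otimes> inv g"
      using conj_class_sym[of x u] assms by (auto simp: conj_class_def)
    ultimately have "x = u" using Z_commute[of u "inv g"] by (simp add: m_assoc)
    then show False using x \<open>u \<in> Z\<close> by simp
  qed
qed

text \<open>If \<open>w\<close> were noncentral, every class of size \<open>p\<close> would meet \<open>C w\<close>, since conjugation by \<open>w\<close> has
  order dividing \<open>q\<close> there; but \<open>C w\<close> is too small for that.\<close>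

lemma pow_prime_central:
  assumes q: "Factorial_Ring.prime q" "q \<noteq> p" and w: "w \<in> carrier G" and wq: "w [^] (q::nat) \<in> Z"
  shows "w \<in> Z"
proof (rule ccontr)
  assume "w \<notin> Z"
  have meets: "\<exists>u \<in> C w - Z. x \<in> conj_class u" if x: "x \<in> carrier G - Z" for x
  proof -
    let ?f = "\<lambda>u. w \<otimes> u \<otimes> inv w"
    have cl: "conj_class x \<subseteq> carrier G" using conj_class_closed x by simp
    have pow: "(?f ^^ i) u = w [^] i \<otimes> u \<otimes> inv (w [^] i)" if "u \<in> carrier G" for i u
    proof (induction i)
      case (Suc i)
      have "w [^] Suc i = w \<otimes> w [^] i" using w by (rule nat_pow_Suc2)
      then show ?case using that w Suc by (simp add: m_assoc inv_mult_group del: nat_pow_Suc)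
    qed (use that in simp)
    have "\<exists>u \<in> conj_class x. ?f u = u"
    proof (rule ccontr)
      assume "\<not> (\<exists>u \<in> conj_class x. ?f u = u)"
      then have "q dvd card (conj_class x)"
      proof (intro prime_dvd_card_if_no_fixpoint[where f = ?f])
        show "finite (conj_class x)" using cl fin finite_subset by blast
        show "(?f ^^ q) u = u" if "u \<in> conj_class x" for u
        proof -
          have "u \<in> carrier G" using that cl by blast
          then show ?thesis using pow[of u q] Z_commute[OF wq] w by (simp add: m_assoc)
        qed
      qed (use q w x conj_class_conj in auto)
      then show False using card_class[OF x] q prime_p by (simp add: primes_dvd_imp_eq)
    qed
    then obtain u where u: "u \<in> conj_class x" "?f u = u" by blast
    then have uG: "u \<in> carrier G - Z" using conj_class_noncentral x by blast
    have "u \<in> C w" using mem_centralizer_iff_conj[of u w] centralizer_mem_commute[of u w] u uG w by simp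
    then show ?thesis using uG conj_class_sym u x by blast
  qed
  \<comment> \<open>The classes of the noncentral elements of \<open>C w\<close> cover all
    noncentral elements, yet together they have at most
    \<open>p * (card (C w) - card Z) = order G - p * card Z\<close> elements, fewer than
    \<open>order G - card Z\<close>.\<close>
  have "card (carrier G - Z) \<le> card (\<Union>u \<in> C w - Z. conj_class u)"
  proof (rule card_mono)
    show "finite (\<Union>u \<in> C w - Z. conj_class u)"
      using finite_C fin by (auto simp: conj_class_def)
    show "carrier G - Z \<subseteq> (\<Union>u \<in> C w - Z. conj_class u)" using meets by blast
  qed
  also have "\<dots> \<le> (\<Sum>u \<in> C w - Z. card (conj_class u))"
    using finite_C by (intro card_UN_le) simp
  also have "\<dots> = p * (card (C w) - card Z)"
  proof -
    have "(\<Sum>u \<in> C w - Z. card (conj_class u)) = (\<Sum>u \<in> C w - Z. p)"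
      by (rule sum.cong) (auto intro!: card_class C_closed)
    then show ?thesis
      using finite_Z group_center_subset_centralizer[OF w] by (simp add: card_Diff_subset)
  qed
  also have "\<dots> = order G - p * card Z"
    using card_centralizer[of w] w \<open>w \<notin> Z\<close> by (simp add: diff_mult_distrib2)
  finally have "order G - card Z \<le> order G - p * card Z"
    using finite_Z Z_closed by (simp add: card_Diff_subset order_def subset_iff)
  moreover have "card Z < p * card Z" using card_Z_pos prime_gt_1_nat[OF prime_p] by simp
  \<comment> \<open>Excludes truncation in \<open>order G - p * card Z\<close>.\<close>
  moreover have "p * card Z \<le> order G"
    using card_mono[OF finite_C group_center_subset_centralizer[OF w]] card_centralizer[of w] w \<open>w \<notin> Z\<close>
    by (metis DiffI mult_le_mono2)
  ultimately show False by linarith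
qed

lemma pow_prime_power_central:
  assumes "g \<in> carrier G"
  shows "\<exists>k. g [^] (p ^ k) \<in> Z"
proof -
  have "\<exists>k. g [^] (p ^ k) \<in> Z" if "n > 0" "g [^] n \<in> Z" "g \<in> carrier G" for n :: nat and g
    using that
  proof (induction n arbitrary: g rule: less_induct)
    case (less n)
    show ?case
    proof (cases "n = 1")
      case True
      then show ?thesis using less.prems by (intro exI[of _ 0]) simp
    next
      case False
      then obtain q where q: "Factorial_Ring.prime q" "q dvd n" using prime_factor_nat by blast
      then obtain m where n: "n = q * m" by (elim dvdE)
      have m: "m < n" "m > 0" using less.prems n prime_gt_1_nat[OF q(1)] by auto
      show ?thesis
      proof (cases "q = p")
        case True
        then have "(g [^] p) [^] m \<in> Z" using less.prems n by (simp add: nat_pow_pow)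
        then obtain k where "(g [^] p) [^] (p ^ k) \<in> Z" using less m by blast
        then have "g [^] (p ^ Suc k) \<in> Z" using less.prems by (simp add: nat_pow_pow)
        then show ?thesis by blast
      next
        case False
        have gmq: "(g [^] m) [^] q \<in> Z" using less.prems n by (simp add: nat_pow_pow mult.commute)
        have "g [^] m \<in> Z"
          by (rule pow_prime_central[OF q(1) False nat_pow_closed[OF less.prems(3)] gmq])
        then show ?thesis using less m by blast
      qed
    qed
  qed
  from this[of "order G"] show ?thesis
    using assms fin order_gt_0_iff_finite pow_order_eq_1 subgroup.one_closed[OF group_center_subgroup] by simp
qed

text \<open>If \<open>h \<in> C x\<close> moves \<open>x'\<close>, then under a suitable \<open>p\<close>-power of \<open>h\<close> the orbit of \<open>x'\<close> has size \<open>p\<close>. It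
  avoids the fixed point \<open>x\<close>, which makes the class too large.\<close>

lemma centralizer_conj_class:
  assumes x: "x \<in> carrier G - Z" and x': "x' \<in> conj_class x"
  shows "C x \<subseteq> C x'"
proof
  fix h assume h: "h \<in> C x"
  then have hG: "h \<in> carrier G" by (rule C_closed)
  have x'G: "x' \<in> carrier G" using conj_class_closed x x' by auto
  have subC: "subgroup (C x') G" "subgroup (C x) G" using centralizer_subgroup x'G x by auto
  show "h \<in> C x'"
  proof (rule ccontr)
    assume "h \<notin> C x'"
    \<comment> \<open>By minimality the element \<open>w\<close> below lies outside
      \<open>C x'\<close> while \<open>w [^] p\<close> lies inside, so conjugation by
      \<open>w\<close> moves \<open>x'\<close> in a cycle of length \<open>p\<close>.\<close>
    define k where "k = (LEAST k. h [^] (p ^ k) \<in> C x')"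
    have "\<exists>k. h [^] (p ^ k) \<in> C x'"
      using pow_prime_power_central[OF hG] group_center_subset_centralizer[OF x'G] by auto
    then have k: "h [^] (p ^ k) \<in> C x'" unfolding k_def by (rule LeastI_ex)
    have "k \<noteq> 0"
    proof
      assume "k = 0"
      then show False using k \<open>h \<notin> C x'\<close> hG by simp
    qed
    then obtain j where j: "k = Suc j" by (cases k) auto
    define w where "w = h [^] (p ^ j)"
    have w: "w \<in> carrier G" "w \<in> C x" "w \<notin> C x'" "w [^] p \<in> C x'"
    proof -
      show "w \<in> carrier G" using hG by (simp add: w_def)
      show "w \<in> C x" using subgroup_int_pow_closed[OF subC(2) h, of "int (p ^ j)"]
        by (simp add: w_def int_pow_int del: of_nat_power)
      show "w \<notin> C x'" using not_less_Least[of j "\<lambda>k. h [^] (p ^ k) \<in> C x'"] j by (simp add: w_def k_def)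
      show "w [^] p \<in> C x'" using k j hG by (simp add: w_def nat_pow_pow mult.commute)
    qed
    let ?o = "\<lambda>i::nat. w [^] i \<otimes> x' \<otimes> inv (w [^] i)"
    have "inj_on ?o {..<p}"
    proof (rule linorder_inj_onI')
      fix i l assume il: "i \<in> {..<p}" "l \<in> {..<p}" "i < l"
      show "?o i \<noteq> ?o l"
      proof
        assume eq: "?o i = ?o l"
        define d where "d = l - i"
        have "w [^] l = w [^] i \<otimes> w [^] d" using il w by (simp add: d_def nat_pow_mult)
        then have "?o l = w [^] i \<otimes> (w [^] d \<otimes> x' \<otimes> inv (w [^] d)) \<otimes> inv (w [^] i)"
          using w x'G by (simp add: m_assoc inv_mult_group)
        then have "w [^] d \<otimes> x' \<otimes> inv (w [^] d) = x'"
          using eq w x'G by simp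
        then have "w [^] d \<in> C x'" using mem_centralizer_iff_conj[of x' "w [^] d"] w x'G by simp
        moreover have "coprime p d"
          using il prime_p by (intro prime_imp_coprime) (auto simp: d_def dest: dvd_imp_le)
        ultimately have "w \<in> C x'" using coprime_pow_mem[OF subC(1) w(1) w(4)] by blast
        then show False using w by simp
      qed
    qed
    then have "card (?o ` {..<p}) = p" by (simp add: card_image)
    \<comment> \<open>Powers of \<open>w\<close> fix \<open>x\<close>; were \<open>x\<close> on the
      orbit of \<open>x'\<close>, then \<open>x' = x\<close>, although \<open>w\<close> commutes
      with \<open>x\<close> and not with \<open>x'\<close>.\<close>
    moreover have "x \<notin> ?o ` {..<p}"
    proof
      assume "x \<in> ?o ` {..<p}"
      then obtain i where i: "x = ?o i" by blast
      have "w [^] i \<in> C x"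
        using subgroup_int_pow_closed[OF subC(2) w(2), of "int i"] by (simp add: int_pow_int)
      then have "?o i = w [^] i \<otimes> x \<otimes> inv (w [^] i)"
        using mem_centralizer_iff_conj[of x "w [^] i"] i w x by simp
      then have "x' = x" using w x'G x by simp
      then show False using w by simp
    qed
    ultimately have "Suc p = card (insert x (?o ` {..<p}))" by simp
    also have "\<dots> \<le> card (conj_class x)"
    proof (rule card_mono)
      show "finite (conj_class x)" using fin by (simp add: conj_class_def)
      show "insert x (?o ` {..<p}) \<subseteq> conj_class x"
        using conj_class_conj[OF _ x'] x w conj_class_self by auto
    qed
    finally show False using card_class[OF x] by simp
  qed
qed

text \<open>By \<open>centralizer_conj_class\<close>, an element commuting with \<open>x\<close>
  commutes with all conjugates of \<open>x\<close>; conjugating this relation by \<open>g\<close>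
  moves the conjugation onto the element.\<close>

lemma centralizer_normal:
  assumes x: "x \<in> carrier G - Z"
  shows "C x \<lhd> G"
  unfolding normal_inv_iff
proof (intro conjI ballI)
  show "subgroup (C x) G" using x centralizer_subgroup by simp
  fix g h assume g: "g \<in> carrier G" and h: "h \<in> C x"
  have hG: "h \<in> carrier G" using h by (rule C_closed)
  have "inv g \<otimes> x \<otimes> g \<in> conj_class x"
    using g by (auto simp: conj_class_def intro!: image_eqI[of _ _ "inv g"])
  then have "h \<in> C (inv g \<otimes> x \<otimes> g)" using centralizer_conj_class x h by blast
  then have "h \<otimes> (inv g \<otimes> x \<otimes> g) = (inv g \<otimes> x \<otimes> g) \<otimes> h" by (rule C_commute)
  then have "g \<otimes> (h \<otimes> (inv g \<otimes> x \<otimes> g)) \<otimes> inv g = g \<otimes> ((inv g \<otimes> x \<otimes> g) \<otimes> h) \<otimes> inv g" by simp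
  then have "g \<otimes> h \<otimes> inv g \<otimes> x = x \<otimes> (g \<otimes> h \<otimes> inv g)"
    using g hG x by (simp add: m_assoc)
  then show "g \<otimes> h \<otimes> inv g \<in> C x" unfolding centralizer_def using g hG by simp
qed

lemma commutator_closed [simp]:
  "x \<in> carrier G \<Longrightarrow> y \<in> carrier G \<Longrightarrow> commutator G x y \<in> carrier G"
  by (simp add: commutator_def)

text \<open>For noncentral \<open>u\<close> the quotient by the normal subgroup \<open>C u\<close>
  has prime order and is abelian, so the derived subgroup lies in \<open>C u\<close>. The center is
  the intersection of all \<open>C u\<close>.\<close>

lemma commutator_central:
  assumes "x \<in> carrier G" "y \<in> carrier G"
  shows "commutator G x y \<in> Z"
proof -
  have "commutator G x y \<in> C u" if u: "u \<in> carrier G" for u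
  proof (cases "u \<in> Z")
    case True
    then show ?thesis using C_Z assms by simp
  next
    case False
    interpret N: normal "C u" G using centralizer_normal u False by simp
    interpret Q: group "G Mod C u" by (rule N.factorgroup_is_group)
    have "order (G Mod C u) = p"
      using conj_type u False by (simp add: conjugate_type_def order_def FactGroup_def)
    then have "comm_group (G Mod C u)" using Q.prime_order_comm_group prime_p by simp
    then have "derived G (carrier G) \<subseteq> C u"
      using derived_minimal N.normal_axioms by blast
    moreover have "commutator G x y \<in> derived G (carrier G)"
      unfolding derived_def commutator_def using assms by (intro generate.incl) blast
    ultimately show ?thesis by blast
  qed
  then show ?thesis unfolding group_center_eq using assms by simp
qed

subsection \<open>The commutator subgroup has order p\<close>

lemma commutator_mult: "x \<in> carrier G \<Longrightarrow> y \<in> carrier G \<Longrightarrow> commutator G x y \<otimes> (y \<otimes> x) = x \<otimes> y"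
  by (simp add: commutator_def m_assoc)

lemma commutator_eqI:
  assumes "x \<in> carrier G" "y \<in> carrier G" "k \<in> carrier G" "x \<otimes> y = k \<otimes> (y \<otimes> x)"
  shows "commutator G x y = k"
proof -
  have "commutator G x y \<otimes> (y \<otimes> x) = k \<otimes> (y \<otimes> x)" using commutator_mult assms by simp
  then show ?thesis using assms r_cancel[of "y \<otimes> x"] by simp
qed

lemma commutator_eq_one_iff:
  "x \<in> carrier G \<Longrightarrow> y \<in> carrier G \<Longrightarrow> commutator G x y = \<one> \<longleftrightarrow> x \<otimes> y = y \<otimes> x"
  using commutator_eqI[of x y \<one>] commutator_mult[of x y] by fastforce

lemma commutator_self: "x \<in> carrier G \<Longrightarrow> commutator G x x = \<one>"
  by (simp add: commutator_eq_one_iff)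

lemma commutator_swap:
  assumes "x \<in> carrier G" "y \<in> carrier G"
  shows "commutator G y x = inv (commutator G x y)"
  using assms by (simp add: commutator_def inv_mult_group m_assoc)

text \<open>Moving \<open>z\<close> past \<open>y\<close> and then past \<open>x\<close> splits off
  one commutator each; both are central and can be collected in front.\<close>

lemma commutator_mult_left:
  assumes x: "x \<in> carrier G" and y: "y \<in> carrier G" and z: "z \<in> carrier G"
  shows "commutator G (x \<otimes> y) z = commutator G x z \<otimes> commutator G y z"
proof (rule commutator_eqI)
  let ?k = "commutator G x z" and ?l = "commutator G y z"
  have "x \<otimes> y \<otimes> z = x \<otimes> (?l \<otimes> (z \<otimes> y))" using assms commutator_mult[OF y z] by (simp add: m_assoc)
  also have "\<dots> = (?l \<otimes> x) \<otimes> (z \<otimes> y)"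
    using assms Z_commute[OF commutator_central[OF y z] x] by (simp add: m_assoc)
  also have "\<dots> = ?l \<otimes> (x \<otimes> z) \<otimes> y" using assms by (simp add: m_assoc)
  also have "\<dots> = ?l \<otimes> (?k \<otimes> (z \<otimes> x)) \<otimes> y" using commutator_mult[OF x z] by simp
  also have "\<dots> = (?l \<otimes> ?k) \<otimes> (z \<otimes> (x \<otimes> y))" using assms by (simp add: m_assoc)
  also have "?l \<otimes> ?k = ?k \<otimes> ?l" using Z_commute commutator_central assms by simp
  finally show "x \<otimes> y \<otimes> z = ?k \<otimes> ?l \<otimes> (z \<otimes> (x \<otimes> y))" .
qed (use assms in auto)

lemma commutator_mult_right:
  assumes x: "x \<in> carrier G" and y: "y \<in> carrier G" and z: "z \<in> carrier G"
  shows "commutator G z (x \<otimes> y) = commutator G z x \<otimes> commutator G z y"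
proof -
  have "commutator G z (x \<otimes> y) = inv (commutator G x z \<otimes> commutator G y z)"
    using commutator_swap[of "x \<otimes> y" z] commutator_mult_left assms by simp
  also have "\<dots> = commutator G z y \<otimes> commutator G z x"
    using assms commutator_swap[of x z] commutator_swap[of y z] by (simp add: inv_mult_group)
  also have "\<dots> = commutator G z x \<otimes> commutator G z y"
    using Z_commute commutator_central assms by simp
  finally show ?thesis .
qed

lemma commutator_group_hom: "x \<in> carrier G \<Longrightarrow> group_hom G G (commutator G x)"
  by (unfold_locales) (simp add: hom_def commutator_mult_right)

lemma commutator_int_pow_right:
  "x \<in> carrier G \<Longrightarrow> y \<in> carrier G \<Longrightarrow> commutator G x (y [^] (i::int)) = commutator G x y [^] i"
  using group_hom.hom_int_pow[OF commutator_group_hom] by blast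

lemma commutator_int_pow_left:
  assumes "x \<in> carrier G" "y \<in> carrier G"
  shows "commutator G (y [^] (i::int)) x = commutator G y x [^] i"
  using commutator_swap[of x "y [^] i"] commutator_swap[of x y] commutator_int_pow_right[of x y i] assms
  by (simp add: int_pow_inv)

lemma commutator_central_eq_one:
  "z \<in> Z \<Longrightarrow> x \<in> carrier G \<Longrightarrow> commutator G z x = \<one>"
  "z \<in> Z \<Longrightarrow> x \<in> carrier G \<Longrightarrow> commutator G x z = \<one>"
  using Z_commute[of z x] Z_closed[of z] by (simp_all add: commutator_eq_one_iff)

lemma mem_C_iff_commutator:
  "g \<in> carrier G \<Longrightarrow> x \<in> carrier G \<Longrightarrow> g \<in> C x \<longleftrightarrow> commutator G g x = \<one>"
  unfolding centralizer_def by (simp add: commutator_eq_one_iff)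

lemma mem_Z_iff_commutator:
  "z \<in> carrier G \<Longrightarrow> z \<in> Z \<longleftrightarrow> (\<forall>g \<in> carrier G. commutator G z g = \<one>)"
  unfolding group_center_def by (auto simp: commutator_eq_one_iff)

text \<open>By bilinearity, equal commutators mean that \<open>x \<otimes> inv y\<close> commutes
  with everything. Thus the form induced on \<open>G/Z\<close> is nondegenerate.\<close>

lemma Z_rcos_eq_iff:
  assumes x: "x \<in> carrier G" and y: "y \<in> carrier G"
  shows "Z #> x = Z #> y \<longleftrightarrow> (\<forall>g \<in> carrier G. commutator G x g = commutator G y g)"
proof
  assume "Z #> x = Z #> y"
  then have "x \<in> Z #> y" using rcos_self[OF x group_center_subgroup] by simp
  then obtain z where z: "z \<in> Z" "x = z \<otimes> y" by (auto simp: r_coset_def)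
  show "\<forall>g \<in> carrier G. commutator G x g = commutator G y g"
    using z y commutator_mult_left[of z y] commutator_central_eq_one(1)[OF z(1)] Z_closed[OF z(1)] by simp
next
  assume *: "\<forall>g \<in> carrier G. commutator G x g = commutator G y g"
  have "commutator G (x \<otimes> inv y) g = \<one>" if "g \<in> carrier G" for g
  proof -
    have "commutator G (inv y) g = inv (commutator G y g)"
      using commutator_int_pow_left[of g y "-1"] that y by (simp add: int_pow_neg)
    then show ?thesis using * that x y by (simp add: commutator_mult_left)
  qed
  then have "x \<otimes> inv y \<in> Z" using mem_Z_iff_commutator x y by simp
  then have "x \<in> Z #> y" unfolding r_coset_def using x y by (force simp: m_assoc)
  then show "Z #> x = Z #> y" using repr_independence[OF _ y group_center_subgroup] by simp
qed

lemma exists_noncentral: "\<exists>x. x \<in> carrier G - Z"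
proof (rule ccontr)
  assume "\<not> (\<exists>x. x \<in> carrier G - Z)"
  then have "comm_group G" using Z_commute by (intro group_comm_groupI) blast
  then show False using conj_type by (simp add: conjugate_type_def)
qed

section \<open>Commutators with a fixed first entry\<close>

abbreviation commutators :: "'a \<Rightarrow> 'a set" where
  "commutators x \<equiv> commutator G x ` carrier G"

lemma commutators_subgroup: "x \<in> carrier G \<Longrightarrow> subgroup (commutators x) G"
  using group_hom.img_is_subgroup[OF commutator_group_hom] .

text \<open>A commutator of \<open>x\<close> with \<open>g\<close> is \<open>x\<close> times the
  conjugate of \<open>inv x\<close> by \<open>g\<close>, so \<open>commutators x\<close> is a
  translate of the class of \<open>inv x\<close>.\<close>

lemma card_commutators:
  assumes x: "x \<in> carrier G - Z"
  shows "card (commutators x) = p"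
proof -
  have "inv x \<notin> Z" using x subgroup.m_inv_closed[OF group_center_subgroup, of "inv x"] by auto
  then have "card (conj_class (inv x)) = p" using card_class x by simp
  moreover have "commutators x = (\<lambda>u. x \<otimes> u) ` conj_class (inv x)"
    using x by (auto simp: conj_class_def commutator_def image_image m_assoc)
  moreover have "inj_on (\<lambda>u. x \<otimes> u) (conj_class (inv x))"
    using x conj_class_closed[of "inv x"] by (intro inj_onI) (auto simp: subset_iff)
  ultimately show ?thesis by (simp add: card_image)
qed

text \<open>Both sides are subgroups of prime order, hence generated by the common element
  \<open>k\<close>.\<close>

lemma commutators_eqI:
  assumes x: "x \<in> carrier G - Z" and y: "y \<in> carrier G - Z"
    and "k \<in> commutators x" "k \<in> commutators y" "k \<noteq> \<one>"
  shows "commutators x = commutators y"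
  using prime_order_subgroup_generated(2)[OF commutators_subgroup, of _ k] card_commutators[OF x]
    card_commutators[OF y] prime_p assms by (metis DiffD1)

text \<open>If \<open>C x \<noteq> C y\<close>, the commutators of \<open>x \<otimes> y\<close> include nontrivial ones of \<open>x\<close> and of \<open>y\<close>;
  otherwise compare both with an element outside \<open>C x\<close>.\<close>

lemma commutators_eq:
  assumes x: "x \<in> carrier G - Z" and y: "y \<in> carrier G - Z"
  shows "commutators x = commutators y"
proof -
  have distinct: "commutators x = commutators y"
    if x: "x \<in> carrier G - Z" and y: "y \<in> carrier G - Z" and "C x \<noteq> C y" for x y
  proof -
    \<comment> \<open>Distinct proper centralizers are incomparable by \<open>C_eqI\<close>. In
      commutators with \<open>x \<otimes> y\<close>, the element \<open>g\<close> sees only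
      \<open>y\<close> and \<open>h\<close> sees only \<open>x\<close>.\<close>
    obtain g h where g: "g \<in> C x" "g \<notin> C y" and h: "h \<in> C y" "h \<notin> C x"
      using C_eqI[OF x y] C_eqI[OF y x] \<open>C x \<noteq> C y\<close> by blast
    have G: "x \<in> carrier G" "y \<in> carrier G" "g \<in> carrier G" "h \<in> carrier G"
      using x y g h C_closed by auto
    have 1: "commutator G x g = \<one>" "commutator G y h = \<one>"
      "commutator G y g \<noteq> \<one>" "commutator G x h \<noteq> \<one>"
      using g h mem_C_iff_commutator centralizer_mem_commute G by metis+
    have xg: "commutator G (x \<otimes> y) g = commutator G y g" "commutator G (x \<otimes> y) h = commutator G x h"
      using 1 G by (simp_all add: commutator_mult_left)
    have xy: "x \<otimes> y \<in> carrier G - Z"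
      using 1(3) xg(1) G commutator_central_eq_one(1)[of "x \<otimes> y" g] by auto
    have "commutators x = commutators (x \<otimes> y)"
      using commutators_eqI[OF x xy, of "commutator G x h"] 1 xg G by (metis imageI)
    also have "\<dots> = commutators y"
      using commutators_eqI[OF xy y, of "commutator G y g"] 1 xg G by (metis imageI)
    finally show ?thesis .
  qed
  show ?thesis
  proof (cases "C x = C y")
    case True
    obtain z where z: "z \<in> carrier G" "z \<notin> C x"
      using x mem_Z_iff_commutator[of x] mem_C_iff_commutator centralizer_mem_commute by (metis DiffE)
    have "z \<notin> Z" using z group_center_subset_centralizer x by blast
    moreover have "C z \<noteq> C x" using z centralizer_self by auto
    ultimately show ?thesis using distinct[of x z] distinct[of y z] x y z True by auto
  qed (use distinct x y in blast)
qed

text \<open>By \<open>commutators_eq\<close>, the subgroup \<open>commutators x\<close> already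
  contains every commutator, so generating adds nothing.\<close>

lemma derived_eq_commutators:
  assumes x: "x \<in> carrier G - Z"
  shows "derived G (carrier G) = commutators x"
proof
  have sub: "subgroup (commutators x) G" using commutators_subgroup x by simp
  have "commutator G g h \<in> commutators x" if gh: "g \<in> carrier G" "h \<in> carrier G" for g h
  proof (cases "g \<in> Z")
    case True
    then show ?thesis using commutator_central_eq_one gh subgroup.one_closed[OF sub] by simp
  next
    case False
    then have "commutators g = commutators x" using commutators_eq gh x by blast
    then show ?thesis using gh by blast
  qed
  then show "derived G (carrier G) \<subseteq> commutators x"
    unfolding derived_def by (intro generate_subgroup_incl[OF _ sub]) (auto simp: commutator_def)
  show "commutators x \<subseteq> derived G (carrier G)"
    using x unfolding derived_def commutator_def by (force intro: generate.incl)
qed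

lemma derived_cyclic:
  obtains c where "c \<in> carrier G" "ord c = p" "derived G (carrier G) = range (\<lambda>i::int. c [^] i)"
    "c \<noteq> \<one>"
proof -
  obtain x where x: "x \<in> carrier G - Z" using exists_noncentral by blast
  then obtain g where g: "g \<in> carrier G" "commutator G x g \<noteq> \<one>" using mem_Z_iff_commutator by blast
  have sub: "subgroup (commutators x) G" using commutators_subgroup x by simp
  show ?thesis
    using that[of "commutator G x g"] prime_order_subgroup_generated[OF sub, of "commutator G x g"]
      card_commutators[OF x] prime_p derived_eq_commutators[OF x] g x by simp
qed

subsection \<open>The number of centralizers\<close>

text \<open>Commutators of \<open>x [^] i\<close> are \<open>i\<close>-th powers of commutators of
  \<open>x\<close>, and the nontrivial ones of these have order \<open>p\<close>. Hence
  \<open>G/Z\<close> has exponent \<open>p\<close>.\<close>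

lemma pow_mem_Z_iff:
  assumes x: "x \<in> carrier G - Z"
  shows "x [^] (i::int) \<in> Z \<longleftrightarrow> int p dvd i"
proof -
  obtain g where g: "g \<in> carrier G" "commutator G x g \<noteq> \<one>" using mem_Z_iff_commutator x by blast
  have ordc: "ord (commutator G y h) = p" if "commutator G y h \<noteq> \<one>" "h \<in> carrier G" "y \<in> carrier G - Z" for y h
    using prime_order_subgroup_generated(1)[OF commutators_subgroup, of y] card_commutators[of y] prime_p that by simp
  show ?thesis
  proof
    assume "x [^] i \<in> Z"
    then have "commutator G x g [^] i = \<one>"
      using commutator_central_eq_one(1)[of "x [^] i" g] commutator_int_pow_left[of g x i] g x by simp
    then show "int p dvd i" using int_pow_eq_id[of "commutator G x g"] ordc[of x g] g x by simp
  next
    assume "int p dvd i"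
    then have "commutator G (x [^] i) h = \<one>" if "h \<in> carrier G" for h
      using commutator_int_pow_left[of h x i] ordc[of x h] int_pow_eq_id[of "commutator G x h" i] that x
      by (cases "commutator G x h = \<one>") simp_all
    then show "x [^] i \<in> Z" using mem_Z_iff_commutator x by simp
  qed
qed

text \<open>If \<open>C y = C x\<close>, pick \<open>g \<notin> C x\<close> and \<open>i\<close> with \<open>[y, g] = [x, g]\<^sup>i\<close>: then \<open>y \<otimes> x\<^sup>-\<^sup>i\<close> commutes with
  the maximal subgroup \<open>C x\<close> and with \<open>g\<close>.\<close>

lemma card_same_centralizer:
  assumes x: "x \<in> carrier G - Z"
  shows "card {y \<in> carrier G - Z. C y = C x} = card Z * (p - 1)"
proof -
  \<comment> \<open>Runs through the nonzero points of the line spanned by \<open>x\<close> in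
    \<open>G/Z\<close>; exponent 0 is left out because it gives central elements.\<close>
  let ?f = "\<lambda>(z, i::nat). z \<otimes> x [^] int i"
  have xG: "x \<in> carrier G" using x by simp
  have p0: "0 < p" using prime_p prime_gt_0_nat by blast
  have x_pow_noncentral: "x [^] i \<notin> Z" if "0 < i" "i < int p" for i
    using pow_mem_Z_iff[OF x, of i] that zdvd_not_zless by auto
  have "bij_betw ?f (Z \<times> {1..<p}) {y \<in> carrier G - Z. C y = C x}"
    unfolding bij_betw_def
  proof (intro conjI)
    have "i = j \<and> z = z'" if z: "z \<in> Z" "z' \<in> Z" and ij: "i < p" "j < p"
      and eq: "z \<otimes> x [^] int i = z' \<otimes> x [^] int j" for i j :: nat and z z'
    proof -
      have G: "z \<in> carrier G" "z' \<in> carrier G" using z Z_closed by auto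
      have "x [^] (int i - int j) = x [^] int i \<otimes> inv (x [^] int j)"
        using xG by (simp add: int_pow_diff)
      also have "x [^] int i = inv z \<otimes> (z' \<otimes> x [^] int j)"
        using eq[symmetric] G xG inv_cancel_left(1)[of z "x [^] int i"] by simp
      also have "inv z \<otimes> (z' \<otimes> x [^] int j) \<otimes> inv (x [^] int j) = inv z \<otimes> z'"
        using G xG by (simp add: m_assoc)
      finally have "x [^] (int i - int j) \<in> Z"
        using z subgroup.m_closed[OF group_center_subgroup] subgroup.m_inv_closed[OF group_center_subgroup] by simp
      then have "int p dvd int i - int j" using pow_mem_Z_iff x by simp
      then have "i = j" using ij zdvd_imp_le[of "int p" "int i - int j"] zdvd_imp_le[of "int p" "int j - int i"]
        by (cases "int i < int j"; cases "int j < int i") (auto simp: dvd_diff_commute)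
      then show ?thesis using eq G xG by simp
    qed
    then show "inj_on ?f (Z \<times> {1..<p})" by (fastforce intro: inj_onI)
    show "?f ` (Z \<times> {1..<p}) = {y \<in> carrier G - Z. C y = C x}"
    proof (intro equalityI subsetI)
      fix y assume "y \<in> ?f ` (Z \<times> {1..<p})"
      then obtain z i where z: "z \<in> Z" and i: "i \<in> {1..<p}" and y: "y = z \<otimes> x [^] int i" by auto
      have G: "z \<in> carrier G" "y \<in> carrier G" using z y xG Z_closed by auto
      have com: "commutator G y g = commutator G x g [^] int i" if "g \<in> carrier G" for g
        using that y G xG z commutator_central_eq_one(1) commutator_int_pow_left[of g x "int i"]
        by (simp add: commutator_mult_left)
      have "y \<notin> Z"
      proof
        assume "y \<in> Z"
        then have "inv z \<otimes> y \<in> Z"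
          using z subgroup.m_closed[OF group_center_subgroup] subgroup.m_inv_closed[OF group_center_subgroup] by simp
        then show False using y G xG x_pow_noncentral[of "int i"] i by simp
      qed
      moreover have "C x \<subseteq> C y"
      proof
        fix g assume g: "g \<in> C x"
        then have gG: "g \<in> carrier G" by (rule C_closed)
        then have "commutator G x g = \<one>" using g mem_C_iff_commutator centralizer_mem_commute xG by metis
        then have "commutator G y g = \<one>" using com gG by simp
        then show "g \<in> C y" using mem_C_iff_commutator centralizer_mem_commute gG G by metis
      qed
      ultimately show "y \<in> {y \<in> carrier G - Z. C y = C x}" using C_eqI[OF x, of y] G by auto
    next
      fix y assume y: "y \<in> {y \<in> carrier G - Z. C y = C x}"
      then have yG: "y \<in> carrier G" by simp
      obtain g where g: "g \<in> carrier G" "commutator G x g \<noteq> \<one>" using mem_Z_iff_commutator x by blast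
      have "commutators y = commutators x" using commutators_eq[of y x] x y by blast
      then have "commutator G y g \<in> commutators x" using g by blast
      then obtain i :: int where i: "commutator G y g = commutator G x g [^] i"
        using prime_order_subgroup_generated(2)[OF commutators_subgroup[OF xG], of "commutator G x g"]
          card_commutators[OF x] prime_p g by auto
      define k where "k = nat (i mod int p)"
      have k: "int k = i mod int p" "k < p" using p0 by (simp_all add: k_def nat_less_iff)
      have "ord (commutator G x g) = p"
        using prime_order_subgroup_generated(1)[OF commutators_subgroup[OF xG], of "commutator G x g"]
          card_commutators[OF x] prime_p g by simp
      then have ik: "commutator G y g = commutator G x g [^] int k"
        using i k int_pow_eq[of "commutator G x g" i "int k"] g xG
        mod_eq_dvd_iff[of "int k" "int p" i] by simp
      define z where "z = y \<otimes> inv (x [^] int k)"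
      have zG: "z \<in> carrier G" using yG xG by (simp add: z_def)
      have z_com: "commutator G z h = commutator G y h \<otimes> inv (commutator G x h [^] int k)" if "h \<in> carrier G" for h
        using that yG xG commutator_int_pow_left[of h x "- int k"]
        by (simp add: z_def commutator_mult_left int_pow_neg)
      have "z \<in> Z"
      proof (rule ccontr)
        \<comment> \<open>For noncentral \<open>z\<close> the inclusion of \<open>C x\<close> in
          \<open>C z\<close> would be an equality, but \<open>g\<close> lies in \<open>C z\<close>
          and not in \<open>C x\<close>.\<close>
        assume "z \<notin> Z"
        have "C x \<subseteq> C z"
        proof
          fix h assume h: "h \<in> C x"
          then have hG: "h \<in> carrier G" and "h \<in> C y" using y C_closed by auto
          then have "commutator G x h = \<one>" "commutator G y h = \<one>"
            using h mem_C_iff_commutator centralizer_mem_commute xG yG by metis+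
          then have "commutator G z h = \<one>" using z_com hG by simp
          then show "h \<in> C z" using mem_C_iff_commutator centralizer_mem_commute hG zG by metis
        qed
        then have "C x = C z" using C_eqI[OF x, of z] zG \<open>z \<notin> Z\<close> by simp
        moreover have "commutator G z g = \<one>" using z_com[OF g(1)] ik g xG by simp
        then have "g \<in> C z" using mem_C_iff_commutator centralizer_mem_commute g zG by metis
        ultimately have "g \<in> C x" by simp
        then show False using mem_C_iff_commutator centralizer_mem_commute g xG by metis
      qed
      moreover have yz: "y = z \<otimes> x [^] int k" using yG xG by (simp add: z_def m_assoc)
      moreover have "k \<noteq> 0"
      proof
        assume "k = 0"
        then have "y = z" using yz zG by simp
        then show False using y \<open>z \<in> Z\<close> by simp
      qed
      ultimately show "y \<in> ?f ` (Z \<times> {1..<p})" using k by (intro image_eqI[of _ _ "(z, k)"]) auto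
    qed
  qed
  then have "card {y \<in> carrier G - Z. C y = C x} = card (Z \<times> {1..<p})" by (simp add: bij_betw_same_card)
  then show ?thesis by (simp add: card_cartesian_product)
qed

text \<open>The noncentral elements are sorted by their centralizers, with fibers of size
  \<open>card Z * (p - 1)\<close>. The subtracted 1 in \<open>card (Cent G) - 1\<close> is the whole
  group, the centralizer of the central elements.\<close>

lemma order_eq_card_Cent: "order G = card Z * (1 + (p - 1) * (card (Cent G) - 1))"
proof -
  let ?N = "carrier G - Z"
  have N: "finite ?N" using fin by simp
  have "carrier G \<notin> C ` ?N"
  proof
    assume "carrier G \<in> C ` ?N"
    then obtain x where x: "x \<in> ?N" "C x = carrier G" by auto
    then have "order G = p * order G" using card_centralizer[of x] by (auto simp: order_def)
    then show False using prime_gt_1_nat[OF prime_p] fin order_gt_0_iff_finite by simp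
  qed
  moreover have "Cent G = insert (carrier G) (C ` ?N)"
  proof -
    have "Cent G = C ` (Z \<union> ?N)" using Z_closed by (auto simp: Cent_def)
    also have "\<dots> = C ` Z \<union> C ` ?N" by (rule image_Un)
    also have "C ` Z = {carrier G}"
      using C_Z subgroup.one_closed[OF group_center_subgroup] by auto
    finally show ?thesis by simp
  qed
  ultimately have Cent: "card (Cent G) - 1 = card (C ` ?N)" using N by simp
  have "card ?N = (\<Sum>M \<in> C ` ?N. card {y \<in> ?N. C y = M})"
    using sum.image_gen[OF N, of "\<lambda>_. 1::nat" C] by simp
  also have "\<dots> = (\<Sum>M \<in> C ` ?N. card Z * (p - 1))"
  proof (rule sum.cong)
    fix M assume "M \<in> C ` ?N"
    then obtain x where "x \<in> ?N" "M = C x" by blast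
    then show "card {y \<in> ?N. C y = M} = card Z * (p - 1)" using card_same_centralizer[of x] by simp
  qed simp
  finally have "card ?N = card Z * ((p - 1) * (card (Cent G) - 1))"
    unfolding Cent by (simp add: ac_simps)
  moreover have "order G = card Z + card ?N"
    using card_Diff_subset[OF finite_Z, of "carrier G"] card_mono[OF fin, of Z] Z_closed
    by (simp add: order_def subset_iff)
  ultimately show ?thesis by (simp add: algebra_simps)
qed

end

subsection \<open>Symplectic coordinates modulo the center\<close>

text \<open>The standard symplectic form on \<open>n\<close> hyperbolic planes, with integers
  representing elements of the field with \<open>p\<close> elements: congruence modulo
  \<open>p\<close> replaces equality.\<close>

definition symp_form :: "nat \<Rightarrow> (nat \<Rightarrow> int \<times> int) \<Rightarrow> (nat \<Rightarrow> int \<times> int) \<Rightarrow> int" where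
  "symp_form n a b = (\<Sum>i<n. fst (a i) * snd (b i) - snd (a i) * fst (b i))"

text \<open>Pairing with unit vectors at position \<open>i\<close> reads off the coordinates:
  \<open>(0, 1)\<close> gives the first one and \<open>(1, 0)\<close> the negative of the
  second.\<close>

lemma symp_form_nondegenerate:
  assumes "\<And>d. m dvd symp_form n a d - symp_form n b d" and "i < n"
  shows "m dvd fst (a i) - fst (b i)" and "m dvd snd (a i) - snd (b i)"
proof -
  have *: "symp_form n a (\<lambda>j. if j = i then (s, t) else (0, 0)) = fst (a i) * t - snd (a i) * s" for a s t
  proof -
    have "symp_form n a (\<lambda>j. if j = i then (s, t) else (0, 0))
        = (\<Sum>j<n. if j = i then fst (a i) * t - snd (a i) * s else 0)"
      unfolding symp_form_def by (rule sum.cong) auto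
    then show ?thesis using \<open>i < n\<close> by simp
  qed
  show "m dvd fst (a i) - fst (b i)"
    using assms(1)[of "\<lambda>j. if j = i then (0, 1) else (0, 0)"] by (simp add: *)
  have "m dvd - snd (a i) - - snd (b i)"
    using assms(1)[of "\<lambda>j. if j = i then (1, 0) else (0, 0)"] by (simp add: *)
  then show "m dvd snd (a i) - snd (b i)" by (simp add: dvd_diff_commute)
qed

lemma symp_form_cong_mod:
  assumes "\<And>i. i < n \<Longrightarrow> m dvd fst (a i) - fst (b i)" and "\<And>i. i < n \<Longrightarrow> m dvd snd (a i) - snd (b i)"
  shows "m dvd symp_form n a d - symp_form n b d"
proof -
  have "symp_form n a d - symp_form n b d
      = (\<Sum>i<n. (fst (a i) - fst (b i)) * snd (d i) - (snd (a i) - snd (b i)) * fst (d i))"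
    unfolding symp_form_def sum_subtractf[symmetric] by (rule sum.cong) (auto simp: algebra_simps)
  also have "m dvd \<dots>" using assms by (intro dvd_sum) (simp add: dvd_diff dvd_mult2)
  finally show ?thesis .
qed

section \<open>Hyperbolic systems and their completion\<close>

context conj_type_group
begin

text \<open>A system of hyperbolic pairs, encoded by the map \<open>\<phi>\<close> from coordinates to products of powers.
  The last clause says that \<open>G\<close> is spanned by the system and its centralizer.\<close>

definition hyperbolic_system :: "'a \<Rightarrow> nat \<Rightarrow> ((nat \<Rightarrow> int \<times> int) \<Rightarrow> 'a) \<Rightarrow> bool" where
  "hyperbolic_system c n \<phi> \<longleftrightarrow>
     (\<forall>a. \<phi> a \<in> carrier G) \<and>
     (\<forall>a b. (\<forall>i<n. a i = b i) \<longrightarrow> \<phi> a = \<phi> b) \<and>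
     (\<forall>a b. commutator G (\<phi> a) (\<phi> b) = c [^] symp_form n a b) \<and>
     (\<forall>g \<in> carrier G. \<exists>a. \<forall>b. commutator G (g \<otimes> \<phi> a) (\<phi> b) = \<one>)"

text \<open>The preimage in \<open>G\<close> of the orthogonal complement of the system; the system
  spans \<open>G/Z\<close> once this is contained in the center.\<close>

definition commuting :: "((nat \<Rightarrow> int \<times> int) \<Rightarrow> 'a) \<Rightarrow> 'a set" where
  "commuting \<phi> = {g \<in> carrier G. \<forall>b. commutator G g (\<phi> b) = \<one>}"

lemma hyperbolic_system_0: "hyperbolic_system c 0 (\<lambda>_. \<one>)"
  using commutator_eq_one_iff by (simp add: hyperbolic_system_def symp_form_def)

text \<open>A step of symplectic Gram-Schmidt: \<open>x\<close> gets a partner \<open>y0\<close>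
  with commutator \<open>c\<close>, and \<open>y0\<close> is corrected by an element of the span to
  become orthogonal to the old pairs. The complement shrinks because \<open>x\<close> leaves
  it.\<close>

lemma hyperbolic_system_extend:
  assumes c: "c \<in> carrier G" "c \<noteq> \<one>" "derived G (carrier G) = range (\<lambda>i::int. c [^] i)"
    and sys: "hyperbolic_system c n \<phi>" and x: "x \<in> commuting \<phi>" "x \<notin> Z"
  shows "\<exists>\<phi>'. hyperbolic_system c (Suc n) \<phi>' \<and> commuting \<phi>' \<subset> commuting \<phi>"
proof -
  have \<phi>: "\<phi> a \<in> carrier G" "commutator G (\<phi> a) (\<phi> b) = c [^] symp_form n a b" for a b
    using sys by (auto simp: hyperbolic_system_def)
  have local: "\<phi> a = \<phi> b" if "\<And>i. i < n \<Longrightarrow> a i = b i" for a b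
    using sys that by (auto simp: hyperbolic_system_def)
  have span: "\<exists>a. \<forall>b. commutator G (g \<otimes> \<phi> a) (\<phi> b) = \<one>" if "g \<in> carrier G" for g
    using sys that by (auto simp: hyperbolic_system_def)
  have xG: "x \<in> carrier G" and x\<phi>: "commutator G x (\<phi> b) = \<one>" for b
    using x by (auto simp: commuting_def)
  \<comment> \<open>The derived subgroup consists of the commutators of \<open>x\<close>, so the
    prescribed generator \<open>c\<close> itself is attained.\<close>
  have "c \<in> derived G (carrier G)" unfolding c(3) using c(1) by (intro image_eqI[of _ _ 1]) auto
  then obtain y0 where y0: "y0 \<in> carrier G" "commutator G x y0 = c"
    using derived_eq_commutators[of x] xG x by auto
  obtain a0 where a0: "\<And>b. commutator G (y0 \<otimes> \<phi> a0) (\<phi> b) = \<one>" using span y0 by blast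
  define y where "y = y0 \<otimes> \<phi> a0"
  have yG: "y \<in> carrier G" and y\<phi>: "commutator G y (\<phi> b) = \<one>" for b
    using y0 \<phi> a0 by (simp_all add: y_def)
  have xy: "commutator G x y = c" using x\<phi> y0 xG \<phi> c by (simp add: y_def commutator_mult_right)
  have yx: "commutator G y x = c [^] (-1::int)"
    using commutator_swap[of x y] xy xG yG c by (simp add: int_pow_neg)
  have \<phi>x: "commutator G (\<phi> b) x = \<one>" and \<phi>y: "commutator G (\<phi> b) y = \<one>" for b
    using commutator_swap[of x "\<phi> b"] commutator_swap[of y "\<phi> b"] xG yG \<phi> x\<phi> y\<phi> by simp_all
  define \<phi>' where "\<phi>' a = \<phi> a \<otimes> x [^] fst (a n) \<otimes> y [^] snd (a n)" for a
  have \<phi>'G: "\<phi>' a \<in> carrier G" for a using \<phi> xG yG by (simp add: \<phi>'_def)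
  have com_r: "commutator G g (\<phi>' b)
      = commutator G g (\<phi> b) \<otimes> commutator G g x [^] fst (b n) \<otimes> commutator G g y [^] snd (b n)"
    if "g \<in> carrier G" for g b
    using that \<phi> xG yG by (simp add: \<phi>'_def commutator_mult_right commutator_int_pow_right)
  have com_l: "commutator G (\<phi>' a) g
      = commutator G (\<phi> a) g \<otimes> commutator G x g [^] fst (a n) \<otimes> commutator G y g [^] snd (a n)"
    if "g \<in> carrier G" for g a
    using that \<phi> xG yG by (simp add: \<phi>'_def commutator_mult_left commutator_int_pow_left)
  have form: "commutator G (\<phi>' a) (\<phi>' b) = c [^] symp_form (Suc n) a b" for a b
  proof -
    have "commutator G (\<phi>' a) (\<phi> b) = c [^] symp_form n a b"
      using \<phi> x\<phi> y\<phi> c by (simp add: com_l)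
    moreover have "commutator G (\<phi>' a) x = c [^] (- snd (a n))"
      using \<phi>x commutator_self[OF xG] yx c xG by (simp add: com_l int_pow_pow)
    moreover have "commutator G (\<phi>' a) y = c [^] fst (a n)"
      using \<phi>y commutator_self[OF yG] xy c yG by (simp add: com_l)
    moreover have "symp_form (Suc n) a b
        = symp_form n a b + - snd (a n) * fst (b n) + fst (a n) * snd (b n)"
      by (simp add: symp_form_def)
    ultimately show ?thesis
      using c by (simp add: com_r \<phi>'G int_pow_pow int_pow_mult int_pow_diff int_pow_neg int_pow_inv)
  qed
  have upd: "\<phi> (b(n := u)) = \<phi> b" for b u by (rule local) simp
  have "\<exists>a. \<forall>b. commutator G (g \<otimes> \<phi>' a) (\<phi>' b) = \<one>" if g: "g \<in> carrier G" for g
  proof -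
    obtain a where a: "\<And>b. commutator G (g \<otimes> \<phi> a) (\<phi> b) = \<one>" using span g by blast
    have gG: "g \<otimes> \<phi> a \<in> carrier G" using g \<phi> by simp
    have "commutator G (g \<otimes> \<phi> a) h \<in> range (\<lambda>i::int. c [^] i)" if "h \<in> carrier G" for h
      unfolding c(3)[symmetric] derived_def commutator_def using that gG by (intro generate.incl) blast
    then obtain i j :: int where i: "commutator G (g \<otimes> \<phi> a) x = c [^] i"
      and j: "commutator G (g \<otimes> \<phi> a) y = c [^] j" using xG yG by (metis imageE)
    \<comment> \<open>The new coordinates cancel the commutators with \<open>x\<close> and
      \<open>y\<close>: \<open>y [^] i\<close> contributes \<open>c [^] (- i)\<close> against
      \<open>x\<close>, and \<open>x [^] (- j)\<close> contributes \<open>c [^] (- j)\<close>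
      against \<open>y\<close>.\<close>
    define a' where "a' = a(n := (- j, i))"
    define u where "u = g \<otimes> \<phi>' a'"
    have u: "u = (g \<otimes> \<phi> a) \<otimes> (x [^] (- j) \<otimes> y [^] i)"
      using g \<phi> xG yG by (simp add: u_def \<phi>'_def a'_def upd m_assoc)
    have uG: "u \<in> carrier G" using u gG xG yG by simp
    have com_u: "commutator G u h
        = commutator G (g \<otimes> \<phi> a) h \<otimes> (commutator G x h [^] (- j) \<otimes> commutator G y h [^] i)"
      if "h \<in> carrier G" for h
      using that gG xG yG unfolding u by (simp add: commutator_mult_left commutator_int_pow_left)
    have "commutator G u (\<phi> b) = \<one>" for b using com_u \<phi> a x\<phi> y\<phi> by simp
    moreover have "commutator G u x = \<one>"
      using com_u[OF xG] i yx commutator_self[OF xG] c by (simp add: int_pow_pow int_pow_mult[symmetric])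
    moreover have "commutator G u y = \<one>"
      using com_u[OF yG] j xy commutator_self[OF yG] c by (simp add: int_pow_mult[symmetric])
    ultimately have "commutator G u (\<phi>' b) = \<one>" for b using com_r[OF uG] by simp
    then show ?thesis unfolding u_def by blast
  qed
  moreover have "\<phi>' a = \<phi>' b" if "\<forall>i<Suc n. a i = b i" for a b
    using local[of a b] that by (simp add: \<phi>'_def)
  ultimately have "hyperbolic_system c (Suc n) \<phi>'"
    unfolding hyperbolic_system_def using \<phi>'G form by blast
  moreover have "commuting \<phi>' \<subset> commuting \<phi>"
  proof
    show "commuting \<phi>' \<subseteq> commuting \<phi>"
    proof
      fix g assume g: "g \<in> commuting \<phi>'"
      \<comment> \<open>Zero coordinates at the new pair recover the old system inside the new
        one.\<close>
      have "\<phi>' (b(n := (0, 0))) = \<phi> b" for b using \<phi> by (simp add: \<phi>'_def upd)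
      then have "commutator G g (\<phi> b) = \<one>" for b using g unfolding commuting_def by (metis (mono_tags, lifting) mem_Collect_eq)
      then show "g \<in> commuting \<phi>" using g by (simp add: commuting_def)
    qed
    \<comment> \<open>The old pairs are orthogonal to \<open>x\<close>, so only the new
      \<open>y\<close>-coordinate 1 contributes.\<close>
    have "commutator G x (\<phi>' (\<lambda>_. (0, 1))) = c"
      using com_r[OF xG] x\<phi> xy xG c by simp
    then have "x \<notin> commuting \<phi>'" using c by (auto simp: commuting_def)
    then show "commuting \<phi>' \<noteq> commuting \<phi>" using x by blast
  qed
  ultimately show ?thesis by blast
qed

text \<open>Extension continues while the complement contains a noncentral element; it ends because
  the complement is finite and shrinks strictly.\<close>

lemma exists_hyperbolic_basis:
  assumes c: "c \<in> carrier G" "c \<noteq> \<one>" "derived G (carrier G) = range (\<lambda>i::int. c [^] i)"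
  obtains n \<phi> where "hyperbolic_system c n \<phi>" "commuting \<phi> \<subseteq> Z"
proof -
  have "\<exists>n' \<phi>'. hyperbolic_system c n' \<phi>' \<and> commuting \<phi>' \<subseteq> Z" if "hyperbolic_system c n \<phi>" for n \<phi>
    using that
  proof (induction "card (commuting \<phi>)" arbitrary: n \<phi> rule: less_induct)
    case less
    show ?case
    proof (cases "commuting \<phi> \<subseteq> Z")
      case False
      then obtain \<phi>' where \<phi>': "hyperbolic_system c (Suc n) \<phi>'" "commuting \<phi>' \<subset> commuting \<phi>"
        using hyperbolic_system_extend[OF c less.prems] by blast
      have "finite (commuting \<phi>)" using fin by (simp add: commuting_def)
      then show ?thesis using less.hyps[of \<phi>'] \<phi>' psubset_card_mono by blast
    qed (use less.prems in blast)
  qed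
  then show ?thesis using hyperbolic_system_0 that by blast
qed

section \<open>Coordinates on the central quotient\<close>

lemma commutator_rcos_cong:
  assumes "Z #> x = Z #> x'" "Z #> y = Z #> y'"
    and "x \<in> carrier G" "x' \<in> carrier G" "y \<in> carrier G" "y' \<in> carrier G"
  shows "commutator G x y = commutator G x' y'"
proof -
  have "commutator G x y = commutator G x' y" using Z_rcos_eq_iff assms by blast
  also have "\<dots> = inv (commutator G y x')" using commutator_swap[of y x'] assms by simp
  also have "commutator G y x' = commutator G y' x'" using Z_rcos_eq_iff assms by blast
  also have "inv (commutator G y' x') = commutator G x' y'" using commutator_swap[of y' x'] assms by simp
  finally show ?thesis .
qed

text \<open>Equality and products of cosets, and the exponents of commutators, are described by
  \<open>n\<close> and \<open>p\<close> alone. Two groups with the same \<open>n\<close> can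
  therefore be compared through their coordinates.\<close>

lemma coordinates:
  obtains c \<phi> n where
    "c \<in> carrier G" "ord c = p" "derived G (carrier G) = range (\<lambda>i::int. c [^] i)"
    "\<And>a. \<phi> a \<in> carrier G"
    "\<And>a b. commutator G (\<phi> a) (\<phi> b) = c [^] symp_form n a b"
    "\<And>g. g \<in> carrier G \<Longrightarrow> \<exists>a. Z #> g = Z #> \<phi> a"
    "\<And>a b. Z #> \<phi> a = Z #> \<phi> b \<longleftrightarrow> (\<forall>d. int p dvd symp_form n a d - symp_form n b d)"
    "\<And>a b. Z #> (\<phi> a \<otimes> \<phi> b) = Z #> \<phi> (\<lambda>i. (fst (a i) + fst (b i), snd (a i) + snd (b i)))"
    "order G = card Z * (p * p) ^ n"
proof -
  obtain c where c: "c \<in> carrier G" "ord c = p" "derived G (carrier G) = range (\<lambda>i::int. c [^] i)" "c \<noteq> \<one>"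
    using derived_cyclic by blast
  obtain n \<phi> where sys: "hyperbolic_system c n \<phi>" "commuting \<phi> \<subseteq> Z"
    using exists_hyperbolic_basis[OF c(1,4,3)] by blast
  have \<phi>: "\<phi> a \<in> carrier G" "commutator G (\<phi> a) (\<phi> b) = c [^] symp_form n a b" for a b
    using sys by (auto simp: hyperbolic_system_def)
  have span: "\<exists>a. Z #> g = Z #> \<phi> a" if g: "g \<in> carrier G" for g
  proof -
    \<comment> \<open>The spanning property is applied to \<open>inv g\<close>: a central
      \<open>inv g \<otimes> \<phi> a\<close> places \<open>g\<close> and \<open>\<phi> a\<close> in
      one coset.\<close>
    have "inv g \<in> carrier G" using g by simp
    then obtain a where "\<And>b. commutator G (inv g \<otimes> \<phi> a) (\<phi> b) = \<one>"
      using sys(1) unfolding hyperbolic_system_def by blast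
    then have "inv g \<otimes> \<phi> a \<in> Z" using g \<phi> sys(2) by (auto simp: commuting_def)
    then have "commutator G (g \<otimes> (inv g \<otimes> \<phi> a)) h = commutator G g h" if "h \<in> carrier G" for h
      using commutator_central_eq_one(1)[of "inv g \<otimes> \<phi> a" h] commutator_mult_left[of g "inv g \<otimes> \<phi> a" h] g \<phi> that
      by simp
    then have "commutator G g h = commutator G (\<phi> a) h" if "h \<in> carrier G" for h
      using that g \<phi> by simp
    then show ?thesis using Z_rcos_eq_iff[of g "\<phi> a"] g \<phi> by blast
  qed
  \<comment> \<open>Testing against the \<open>\<phi> d\<close> suffices because they represent all
    cosets.\<close>
  have rcos_eq: "Z #> x = Z #> y \<longleftrightarrow> (\<forall>d. commutator G x (\<phi> d) = commutator G y (\<phi> d))"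
    if xy: "x \<in> carrier G" "y \<in> carrier G" for x y
  proof
    assume *: "\<forall>d. commutator G x (\<phi> d) = commutator G y (\<phi> d)"
    have "commutator G x g = commutator G y g" if g: "g \<in> carrier G" for g
    proof -
      obtain d where d: "Z #> g = Z #> \<phi> d" using span g by blast
      have "commutator G h g = commutator G h (\<phi> d)" if "h \<in> carrier G" for h
        using commutator_rcos_cong[OF refl d] that g \<phi> by simp
      then show ?thesis using * xy by simp
    qed
    then show "Z #> x = Z #> y" using Z_rcos_eq_iff xy by blast
  qed (use Z_rcos_eq_iff xy \<phi> in blast)
  have ker: "Z #> \<phi> a = Z #> \<phi> b \<longleftrightarrow> (\<forall>d. int p dvd symp_form n a d - symp_form n b d)" for a b
    using rcos_eq[of "\<phi> a" "\<phi> b"] \<phi> int_pow_eq[OF c(1)] c(2) by (simp add: dvd_diff_commute)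
  have mult: "Z #> (\<phi> a \<otimes> \<phi> b) = Z #> \<phi> (\<lambda>i. (fst (a i) + fst (b i), snd (a i) + snd (b i)))" for a b
  proof -
    have "symp_form n (\<lambda>i. (fst (a i) + fst (b i), snd (a i) + snd (b i))) d
        = symp_form n a d + symp_form n b d" for d
      unfolding symp_form_def sum.distrib[symmetric] by (rule sum.cong) (auto simp: algebra_simps)
    then show ?thesis
      using rcos_eq \<phi> c(1) by (simp add: commutator_mult_left int_pow_mult)
  qed
  \<comment> \<open>Vectors with reduced entries; extensionality fixes the values beyond
    \<open>n\<close>, so each coset has exactly one representative in \<open>A\<close>.\<close>
  define A where "A = (\<Pi>\<^sub>E i \<in> {..<n}. {0..<int p} \<times> {0..<int p})"
  have "bij_betw (\<lambda>a. Z #> \<phi> a) A (rcosets Z)"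
    unfolding bij_betw_def
  proof (intro conjI)
    show "inj_on (\<lambda>a. Z #> \<phi> a) A"
    proof (rule inj_onI)
      fix a b assume ab: "a \<in> A" "b \<in> A" "Z #> \<phi> a = Z #> \<phi> b"
      have "a i = b i" if i: "i < n" for i
      proof -
        have *: "u = v" if "u \<in> {0..<int p}" "v \<in> {0..<int p}" "int p dvd u - v" for u v
          using that by (metis atLeastLessThan_iff mod_eq_dvd_iff mod_pos_pos_trivial)
        have "a i \<in> {0..<int p} \<times> {0..<int p}" "b i \<in> {0..<int p} \<times> {0..<int p}"
          using ab(1,2) i by (auto simp: A_def dest: PiE_mem)
        then show ?thesis
          using symp_form_nondegenerate[of "int p" n a b i] ab(3) ker i *[of "fst (a i)" "fst (b i)"]
            *[of "snd (a i)" "snd (b i)"] by (auto simp: prod_eq_iff mem_Times_iff)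
      qed
      then show "a = b" using ab(1,2) unfolding A_def by (intro PiE_ext) auto
    qed
    show "(\<lambda>a. Z #> \<phi> a) ` A = rcosets Z"
    proof (intro equalityI subsetI)
      fix M assume "M \<in> rcosets Z"
      then obtain g where "g \<in> carrier G" "M = Z #> g" by (auto simp: RCOSETS_def)
      then obtain a where a: "M = Z #> \<phi> a" using span by blast
      define b where "b = (\<lambda>i\<in>{..<n}. (fst (a i) mod int p, snd (a i) mod int p))"
      have "0 < p" using prime_p prime_gt_0_nat by blast
      then have "b \<in> A" by (auto simp: b_def A_def)
      moreover have "Z #> \<phi> a = Z #> \<phi> b"
        unfolding ker by (auto simp: b_def intro!: symp_form_cong_mod)
      ultimately show "M \<in> (\<lambda>a. Z #> \<phi> a) ` A" using a by blast
    qed (use \<phi> in \<open>auto simp: RCOSETS_def\<close>)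
  qed
  then have "card (rcosets Z) = (p * p) ^ n"
    by (simp add: bij_betw_same_card[symmetric] A_def card_PiE card_cartesian_product)
  then have "order G = card Z * (p * p) ^ n"
    using lagrange[OF group_center_subgroup] by (simp add: mult.commute)
  then show ?thesis using that c \<phi> span ker mult by blast
qed

end

section \<open>Isoclinism through common coordinates\<close>

theorem proposition3p11:
  fixes p :: nat
    and G :: "('a, 'c) monoid_scheme"
    and H :: "('b, 'd) monoid_scheme"
  assumes "Factorial_Ring.prime p"
    and "group G" and "finite (carrier G)" and "conjugate_type G p"
    and "group H" and "finite (carrier H)" and "conjugate_type H p"
    and "card (Cent G) = card (Cent H)"
  shows "isoclinic G H"
proof -
  interpret G: conj_type_group G p
    using assms by (intro conj_type_group.intro conj_type_group_axioms.intro) auto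
  interpret H: conj_type_group H p
    using assms by (intro conj_type_group.intro conj_type_group_axioms.intro) auto
  obtain c m \<phi> where
    c: "c \<in> carrier G" "G.ord c = p" "derived G (carrier G) = range (\<lambda>i::int. c [^]\<^bsub>G\<^esub> i)"
    and \<phi>: "\<And>a. \<phi> a \<in> carrier G"
      "\<And>a b. commutator G (\<phi> a) (\<phi> b) = c [^]\<^bsub>G\<^esub> symp_form m a b"
      "\<And>g. g \<in> carrier G \<Longrightarrow> \<exists>a. G.Z #>\<^bsub>G\<^esub> g = G.Z #>\<^bsub>G\<^esub> \<phi> a"
      "\<And>a b. G.Z #>\<^bsub>G\<^esub> \<phi> a = G.Z #>\<^bsub>G\<^esub> \<phi> b \<longleftrightarrow> (\<forall>d. int p dvd symp_form m a d - symp_form m b d)"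
      "\<And>a b. G.Z #>\<^bsub>G\<^esub> (\<phi> a \<otimes>\<^bsub>G\<^esub> \<phi> b)
         = G.Z #>\<^bsub>G\<^esub> \<phi> (\<lambda>i. (fst (a i) + fst (b i), snd (a i) + snd (b i)))"
    and m: "order G = card G.Z * (p * p) ^ m"
    by (fact G.coordinates)
  obtain e n \<theta> where
    e: "e \<in> carrier H" "H.ord e = p" "derived H (carrier H) = range (\<lambda>i::int. e [^]\<^bsub>H\<^esub> i)"
    and \<theta>: "\<And>a. \<theta> a \<in> carrier H"
      "\<And>a b. commutator H (\<theta> a) (\<theta> b) = e [^]\<^bsub>H\<^esub> symp_form n a b"
      "\<And>g. g \<in> carrier H \<Longrightarrow> \<exists>a. H.Z #>\<^bsub>H\<^esub> g = H.Z #>\<^bsub>H\<^esub> \<theta> a"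
      "\<And>a b. H.Z #>\<^bsub>H\<^esub> \<theta> a = H.Z #>\<^bsub>H\<^esub> \<theta> b \<longleftrightarrow> (\<forall>d. int p dvd symp_form n a d - symp_form n b d)"
      "\<And>a b. H.Z #>\<^bsub>H\<^esub> (\<theta> a \<otimes>\<^bsub>H\<^esub> \<theta> b)
         = H.Z #>\<^bsub>H\<^esub> \<theta> (\<lambda>i. (fst (a i) + fst (b i), snd (a i) + snd (b i)))"
    and n: "order H = card H.Z * (p * p) ^ n"
    by (fact H.coordinates)
  \<comment> \<open>Dividing the two formulas for the group order by the order of the center leaves
    the order of the central quotient, determined by the number of centralizers.\<close>
  have "(p * p) ^ m = 1 + (p - 1) * (card (Cent G) - 1)"
    using m G.order_eq_card_Cent G.card_Z_pos by (metis mult_left_cancel less_not_refl2)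
  also have "\<dots> = (p * p) ^ n"
    using n H.order_eq_card_Cent H.card_Z_pos \<open>card (Cent G) = card (Cent H)\<close>
    by (metis mult_left_cancel less_not_refl2)
  finally have "(p * p) ^ m = (p * p) ^ n" .
  then have mn: "m = n"
    using prime_gt_1_nat[OF \<open>Factorial_Ring.prime p\<close>] less_1_mult[of p p] power_inject_exp[of "p * p" m n] by blast
  have coset_iff: "G.Z #>\<^bsub>G\<^esub> \<phi> a = G.Z #>\<^bsub>G\<^esub> \<phi> b \<longleftrightarrow> H.Z #>\<^bsub>H\<^esub> \<theta> a = H.Z #>\<^bsub>H\<^esub> \<theta> b" for a b
    by (simp add: \<phi>(4) \<theta>(4) mn)
  have pow_iff: "c [^]\<^bsub>G\<^esub> i = c [^]\<^bsub>G\<^esub> j \<longleftrightarrow> e [^]\<^bsub>H\<^esub> i = e [^]\<^bsub>H\<^esub> j" for i j :: int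
    using G.int_pow_eq[OF c(1)] H.int_pow_eq[OF e(1)] c(2) e(2) by simp
  have carrier_G: "carrier (G Mod G.Z) = range (\<lambda>a. G.Z #>\<^bsub>G\<^esub> \<phi> a)"
    using \<phi>(1,3) by (fastforce simp: FactGroup_def RCOSETS_def)
  have carrier_H: "carrier (H Mod H.Z) = range (\<lambda>a. H.Z #>\<^bsub>H\<^esub> \<theta> a)"
    using \<theta>(1,3) by (fastforce simp: FactGroup_def RCOSETS_def)
  \<comment> \<open>\<open>F\<close> keeps the coordinate vector of a coset; by
    \<open>coset_iff\<close> the chosen vector does not affect the result.\<close>
  define F where "F M = H.Z #>\<^bsub>H\<^esub> \<theta> (SOME a. M = G.Z #>\<^bsub>G\<^esub> \<phi> a)" for M
  have F: "F (G.Z #>\<^bsub>G\<^esub> \<phi> a) = H.Z #>\<^bsub>H\<^esub> \<theta> a" for a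
  proof -
    have "G.Z #>\<^bsub>G\<^esub> \<phi> a = G.Z #>\<^bsub>G\<^esub> \<phi> (SOME b. G.Z #>\<^bsub>G\<^esub> \<phi> a = G.Z #>\<^bsub>G\<^esub> \<phi> b)"
      by (rule someI[where P = "\<lambda>b. G.Z #>\<^bsub>G\<^esub> \<phi> a = G.Z #>\<^bsub>G\<^esub> \<phi> b", OF refl])
    then show ?thesis unfolding F_def using coset_iff by metis
  qed
  \<comment> \<open>\<open>E\<close> keeps the exponent, which \<open>pow_iff\<close> makes
    independent of the choice.\<close>
  define E where "E k = e [^]\<^bsub>H\<^esub> (SOME i::int. k = c [^]\<^bsub>G\<^esub> i)" for k
  have E: "E (c [^]\<^bsub>G\<^esub> i) = e [^]\<^bsub>H\<^esub> i" for i :: int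
  proof -
    have "c [^]\<^bsub>G\<^esub> i = c [^]\<^bsub>G\<^esub> (SOME j::int. c [^]\<^bsub>G\<^esub> i = c [^]\<^bsub>G\<^esub> j)"
      by (rule someI[where P = "\<lambda>j. c [^]\<^bsub>G\<^esub> i = c [^]\<^bsub>G\<^esub> j", OF refl])
    then show ?thesis unfolding E_def using pow_iff by metis
  qed
  have F_iso: "F \<in> iso (G Mod G.Z) (H Mod H.Z)"
  proof (rule isoI)
    show "F \<in> hom (G Mod G.Z) (H Mod H.Z)"
    proof (rule homI)
      fix M N assume "M \<in> carrier (G Mod G.Z)" "N \<in> carrier (G Mod G.Z)"
      then obtain a b where MN: "M = G.Z #>\<^bsub>G\<^esub> \<phi> a" "N = G.Z #>\<^bsub>G\<^esub> \<phi> b" by (auto simp: carrier_G)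
      show "F (M \<otimes>\<^bsub>G Mod G.Z\<^esub> N) = F M \<otimes>\<^bsub>H Mod H.Z\<^esub> F N"
        using normal.rcos_sum[OF G.group_center_normal] normal.rcos_sum[OF H.group_center_normal]
        by (simp add: MN F FactGroup_def \<phi>(1,5) \<theta>(1,5))
    qed (auto simp: carrier_G carrier_H F)
    show "bij_betw F (carrier (G Mod G.Z)) (carrier (H Mod H.Z))"
      unfolding bij_betw_def carrier_G carrier_H by (auto simp: inj_on_def F coset_iff image_image)
  qed
  have E_iso: "E \<in> iso (G\<lparr>carrier := derived G (carrier G)\<rparr>) (H\<lparr>carrier := derived H (carrier H)\<rparr>)"
  proof (rule isoI)
    show "E \<in> hom (G\<lparr>carrier := derived G (carrier G)\<rparr>) (H\<lparr>carrier := derived H (carrier H)\<rparr>)"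
      using c(1) e(1) by (intro homI) (auto simp: c(3) e(3) E G.int_pow_mult[symmetric] H.int_pow_mult[symmetric])
    show "bij_betw E (carrier (G\<lparr>carrier := derived G (carrier G)\<rparr>)) (carrier (H\<lparr>carrier := derived H (carrier H)\<rparr>))"
      unfolding bij_betw_def by (auto simp: c(3) e(3) inj_on_def E pow_iff image_image)
  qed
  have "E (commutator G g1 g2) = commutator H h1 h2"
    if g: "g1 \<in> carrier G" "g2 \<in> carrier G" and h: "h1 \<in> carrier H" "h2 \<in> carrier H"
      and "F (G.Z #>\<^bsub>G\<^esub> g1) = H.Z #>\<^bsub>H\<^esub> h1" "F (G.Z #>\<^bsub>G\<^esub> g2) = H.Z #>\<^bsub>H\<^esub> h2" for g1 g2 h1 h2
  proof -
    obtain a b where a: "G.Z #>\<^bsub>G\<^esub> g1 = G.Z #>\<^bsub>G\<^esub> \<phi> a" and b: "G.Z #>\<^bsub>G\<^esub> g2 = G.Z #>\<^bsub>G\<^esub> \<phi> b"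
      using \<phi>(3) g by metis
    \<comment> \<open>Corresponding cosets share coordinates, so both commutators are powers with
      the same exponent \<open>symp_form n a b\<close>.\<close>
    have h1: "H.Z #>\<^bsub>H\<^esub> h1 = H.Z #>\<^bsub>H\<^esub> \<theta> a" and h2: "H.Z #>\<^bsub>H\<^esub> h2 = H.Z #>\<^bsub>H\<^esub> \<theta> b"
      using that a b F by simp_all
    have "commutator G g1 g2 = commutator G (\<phi> a) (\<phi> b)"
      using G.commutator_rcos_cong[OF a b] g \<phi>(1) by simp
    moreover have "commutator H h1 h2 = commutator H (\<theta> a) (\<theta> b)"
      using H.commutator_rcos_cong[OF h1 h2] h \<theta>(1) by simp
    ultimately show ?thesis by (simp add: \<phi>(2) \<theta>(2) E mn)
  qed
  then show ?thesis unfolding isoclinic_def using F_iso E_iso by blast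
qed

end
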